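(* Let $N \ge 2$ be an integer, let $X_1, \ldots, X_N$ be a sample of real-valued observations, and let $\hat{s}^2(X_1, \ldots, X_N)$ be an average-adjusted unbiased variance computed from the sample $X_1, \ldots, X_N$ (with some fixed admissible coefficients $c_1, \ldots, c_N$). Then the average $$Q = \frac{1}{N!} \sum_{(i_1, \ldots, i_N)} \hat{s}^2\left(X_{i_1}, \ldots, X_{i_N}\right),$$ taken over all permutations $(i_1, \ldots, i_N)$ of the indices $1, \ldots, N$, is equal to the usual unbiased variance $$s^2 = \frac{1}{N-1} \sum_{n=1}^N (X_n - \bar{X})^2, \qquad \bar{X} = \frac{1}{N} \sum_{n=1}^N X_n.$$
   Context: The observations $X_1, \ldots, X_N$ are independent and identically distributed real random variables with mean $\mu$ and finite variance $\sigma^2$; the asserted equality $Q = s^2$ is an identity between functions of the sample. Average-adjusted unbiased variance (AAUV): given real coefficients $c_1, \ldots, c_N$ satisfying $$\sum_{n=1}^N c_n = 1, \qquad \sum_{n=1}^N c_n^2 = \frac{2}{N}$$ (admissible coefficients), the associated AAUV is the function $$\hat{s}^2(x_1, \ldots, x_N) = \frac{1}{N} \sum_{n=1}^N \left( x_n - \sum_{m=1}^N c_m x_m \right)^2.$$ *)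

theory Defs
  imports Complex_Main "HOL-Combinatorics.Permutations"
begin

(* A sample (x_1, ..., x_N) and a coefficient vector (c_1, ..., c_N) are functions
   nat => real of which only the values on {1..N} are used. *)

definition admissible :: "nat \<Rightarrow> (nat \<Rightarrow> real) \<Rightarrow> bool" where
  "admissible N c \<longleftrightarrow>
     (\<Sum>n = 1..N. c n) = 1 \<and> (\<Sum>n = 1..N. (c n)\<^sup>2) = 2 / real N"

definition aauv :: "nat \<Rightarrow> (nat \<Rightarrow> real) \<Rightarrow> (nat \<Rightarrow> real) \<Rightarrow> real" where
  "aauv N c x = (1 / real N) * (\<Sum>n = 1..N. (x n - (\<Sum>m = 1..N. c m * x m))\<^sup>2)"

definition sample_mean :: "nat \<Rightarrow> (nat \<Rightarrow> real) \<Rightarrow> real" where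
  "sample_mean N x = (1 / real N) * (\<Sum>n = 1..N. x n)"

definition unbiased_variance :: "nat \<Rightarrow> (nat \<Rightarrow> real) \<Rightarrow> real" where
  "unbiased_variance N x =
     (1 / (real N - 1)) * (\<Sum>n = 1..N. (x n - sample_mean N x)\<^sup>2)"

(* Only the sample is permuted: the coefficients c_1, ..., c_N stay in place. *)
definition permutation_average_aauv :: "nat \<Rightarrow> (nat \<Rightarrow> real) \<Rightarrow> (nat \<Rightarrow> real) \<Rightarrow> real" where
  "permutation_average_aauv N c x =
     (1 / fact N) * (\<Sum>i | i permutes {1..N}. aauv N c (\<lambda>n. x (i n)))"

end

theory Submission
  imports Defs
begin

text \<open>
  Writing \<open>y\<close> for the sample centered at its mean, the AAUV is \<open>V / N + (\<Sum>m. c m * y m)\<^sup>2\<close>, where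
  \<open>\<Sum>m. y m = 0\<close> and \<open>V = \<Sum>m. (y m)\<^sup>2\<close>. The sum over all permutations \<open>p\<close> of \<open>y (p m) * y (p k)\<close>
  depends only on whether \<open>m = k\<close>, and for fixed \<open>m\<close> these sums add up to \<open>0\<close> over \<open>k\<close>; so the
  off-diagonal value is \<open>- 1 / (N - 1)\<close> times the diagonal one.
\<close>

text \<open>Composing on the right with the transposition of \<open>a\<close> and \<open>b\<close>
  is a bijection on the permutations of \<open>S\<close>, and it moves the evaluation point from
  \<open>a\<close> to \<open>b\<close>.\<close>

lemma sum_permutes_at_eq:
  fixes f :: "'a \<Rightarrow> real"
  assumes "a \<in> S" "b \<in> S"
  shows "(\<Sum>p | p permutes S. f (p a)) = (\<Sum>p | p permutes S. f (p b))"
  using sum_permutations_compose_right[OF permutes_swap_id[OF assms], of "\<lambda>p. f (p a)"]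
  by simp

text \<open>The sum does not depend on the point of evaluation, so it may be summed over all points
  of \<open>S\<close>; after exchanging the sums, every permutation contributes
  \<open>sum f S\<close>.\<close>

lemma sum_permutes_at:
  fixes f :: "'a \<Rightarrow> real"
  assumes "finite S" "a \<in> S"
  shows "real (card S) * (\<Sum>p | p permutes S. f (p a)) = fact (card S) * sum f S"
proof -
  have "real (card S) * (\<Sum>p | p permutes S. f (p a)) = (\<Sum>b\<in>S. \<Sum>p | p permutes S. f (p b))"
    unfolding sum_constant[symmetric] by (intro sum.cong refl sum_permutes_at_eq assms)
  also have "\<dots> = (\<Sum>p | p permutes S. \<Sum>b\<in>S. f (p b))"
    by (rule sum.swap)
  also have "\<dots> = (\<Sum>p | p permutes S. sum f S)"
    using sum.permute[of _ S f] by (auto simp: o_def)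
  also have "\<dots> = fact (card S) * sum f S"
    using card_permutations[OF refl assms(1)] by simp
  finally show ?thesis .
qed

lemma sum_permutes_mult_off_diagonal:
  fixes y :: "'a \<Rightarrow> real"
  assumes "finite S" "a \<in> S" "b \<in> S" "a \<noteq> b" "sum y S = 0"
  shows "(real (card S) - 1) * (\<Sum>p | p permutes S. y (p a) * y (p b))
    = - (\<Sum>p | p permutes S. (y (p a))\<^sup>2)"
proof -
  define P where "P k = (\<Sum>p | p permutes S. y (p a) * y (p k))" for k
  \<comment> \<open>Both \<open>b\<close> and \<open>k\<close> differ from \<open>a\<close>, so the
    transposition exchanging them leaves the factor \<open>y (p a)\<close> alone.\<close>
  have "P k = P b" if "k \<in> S - {a}" for k
    using sum_permutations_compose_right[OF permutes_swap_id[of b S k],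
        of "\<lambda>p. y (p a) * y (p b)"] that assms
    by (auto simp: P_def transpose_def)
  then have "sum P (S - {a}) = (real (card S) - 1) * P b"
    using card.remove[OF assms(1,2)] by simp
  moreover have "sum P S = 0"
  proof -
    have "sum P S = (\<Sum>p | p permutes S. \<Sum>k\<in>S. y (p a) * y (p k))"
      unfolding P_def by (rule sum.swap)
    also have "\<dots> = (\<Sum>p | p permutes S. y (p a) * sum y S)"
      using sum.permute[of _ S y] by (auto simp: o_def sum_distrib_left[symmetric])
    finally show ?thesis using assms by simp
  qed
  moreover have "sum P S = P a + sum P (S - {a})"
    using assms by (simp add: sum.remove)
  ultimately show ?thesis
    by (simp add: P_def power2_eq_square)
qed

lemma sum_permutes_weighted_sum_sq:
  fixes c y :: "'a \<Rightarrow> real"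
  assumes S: "finite S" "2 \<le> card S" and y: "sum y S = 0"
    and c: "sum c S = 1" "(\<Sum>m\<in>S. (c m)\<^sup>2) = 2 / real (card S)"
  shows "(\<Sum>p | p permutes S. (\<Sum>m\<in>S. c m * y (p m))\<^sup>2)
    = fact (card S) * (\<Sum>m\<in>S. (y m)\<^sup>2) / (real (card S) * (real (card S) - 1))"
proof -
  define N where "N = real (card S)"
  have N: "2 \<le> N" using S by (simp add: N_def)
  \<comment> \<open>\<open>A\<close> is the common value of the diagonal sums \<open>P m m\<close>,
    as given by \<open>sum_permutes_at\<close> for the squares of \<open>y\<close>.\<close>
  define A where "A = fact (card S) * (\<Sum>m\<in>S. (y m)\<^sup>2) / N"
  define P where "P m k = (\<Sum>p | p permutes S. y (p m) * y (p k))" for m k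
  have diag: "P m m = A" if "m \<in> S" for m
    using sum_permutes_at[OF S(1) that, of "\<lambda>t. (y t)\<^sup>2"] N
    by (simp add: P_def A_def N_def power2_eq_square field_simps)
  have off: "P m k = - A / (N - 1)" if "m \<in> S" "k \<in> S" "m \<noteq> k" for m k
    using sum_permutes_mult_off_diagonal[OF S(1) that y] diag[OF that(1)] N
    by (simp add: P_def N_def power2_eq_square field_simps)
  \<comment> \<open>The off-diagonal coefficients add up to \<open>1 - c m\<close>, so the row is
    \<open>c m * A - (1 - c m) * A / (N - 1)\<close>.\<close>
  have row: "(\<Sum>k\<in>S. c k * P m k) = (c m * N - 1) * A / (N - 1)" if m: "m \<in> S" for m
  proof -
    have "(\<Sum>k\<in>S. c k * P m k) = c m * P m m + (\<Sum>k\<in>S - {m}. c k * P m k)"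
      using S m by (simp add: sum.remove)
    also have "(\<Sum>k\<in>S - {m}. c k * P m k) = sum c (S - {m}) * (- A / (N - 1))"
      unfolding sum_distrib_right using off m by (intro sum.cong) auto
    also have "sum c (S - {m}) = 1 - c m"
      using S m c by (simp add: sum_diff1)
    finally show ?thesis using diag[OF m] N by (simp add: field_simps)
  qed
  have "(\<Sum>p | p permutes S. (\<Sum>m\<in>S. c m * y (p m))\<^sup>2)
      = (\<Sum>p | p permutes S. \<Sum>m\<in>S. \<Sum>k\<in>S. c m * (c k * (y (p m) * y (p k))))"
    unfolding power2_eq_square sum_product by (simp add: algebra_simps)
  also have "\<dots> = (\<Sum>m\<in>S. \<Sum>p | p permutes S. \<Sum>k\<in>S. c m * (c k * (y (p m) * y (p k))))"
    by (rule sum.swap)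
  also have "\<dots> = (\<Sum>m\<in>S. \<Sum>k\<in>S. \<Sum>p | p permutes S. c m * (c k * (y (p m) * y (p k))))"
    by (intro sum.cong refl sum.swap)
  also have "\<dots> = (\<Sum>m\<in>S. c m * (\<Sum>k\<in>S. c k * P m k))"
    by (simp add: P_def sum_distrib_left)
  also have "\<dots> = (\<Sum>m\<in>S. ((c m)\<^sup>2 * N - c m) * (A / (N - 1)))"
    by (intro sum.cong refl) (simp add: row power2_eq_square left_diff_distrib right_diff_distrib)
  also have "\<dots> = ((\<Sum>m\<in>S. (c m)\<^sup>2) * N - sum c S) * (A / (N - 1))"
    by (simp only: sum_subtractf flip: sum_distrib_right)
  \<comment> \<open>Admissibility makes the first factor \<open>(2 / N) * N - 1 = 1\<close>; this is
    what fixes the constant 2 in the condition on the squares.\<close>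
  also have "\<dots> = A / (N - 1)"
    using c N by (simp add: N_def)
  finally show ?thesis by (simp add: A_def N_def)
qed

text \<open>Since the coefficients sum to 1, the weighted mean moves by the same \<open>t\<close> as
  the sample, and every deviation is unchanged. This permits centering the sample.\<close>

lemma aauv_shift:
  assumes "(\<Sum>n = 1..N. c n) = 1"
  shows "aauv N c (\<lambda>n. x n - t) = aauv N c x"
  using assms by (simp add: aauv_def right_diff_distrib sum_subtractf sum_distrib_right[symmetric])

text \<open>When the squares are expanded, the cross term is a multiple of the sum of the
  \<open>y n\<close> and vanishes.\<close>

lemma aauv_centered:
  assumes "0 < N" "(\<Sum>n = 1..N. y n) = 0"
  shows "aauv N c y = (\<Sum>n = 1..N. (y n)\<^sup>2) / real N + (\<Sum>m = 1..N. c m * y m)\<^sup>2"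
proof -
  define a where "a = (\<Sum>m = 1..N. c m * y m)"
  have "(\<Sum>n = 1..N. (y n - a)\<^sup>2) = (\<Sum>n = 1..N. (y n)\<^sup>2) + N * a\<^sup>2 - 2 * (\<Sum>n = 1..N. y n) * a"
    by (simp add: power2_diff sum.distrib sum_subtractf sum_distrib_left sum_distrib_right)
  then show ?thesis
    using assms unfolding aauv_def a_def[symmetric] by (simp add: field_simps)
qed

theorem theorem3p1:
  fixes N :: nat and c X :: "nat \<Rightarrow> real"
  assumes "N \<ge> 2"
    and "admissible N c"
  shows "permutation_average_aauv N c X = unbiased_variance N X"
proof -
  define y where "y n = X n - sample_mean N X" for n
  define V where "V = (\<Sum>n = 1..N. (y n)\<^sup>2)"
  have c: "sum c {1..N} = 1" "(\<Sum>n\<in>{1..N}. (c n)\<^sup>2) = 2 / real (card {1..N})"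
    using assms by (auto simp: admissible_def)
  have y: "sum y {1..N} = 0"
    using assms by (simp add: y_def sample_mean_def sum_subtractf)
  have "aauv N c (\<lambda>n. X (p n)) = V / N + (\<Sum>m = 1..N. c m * y (p m))\<^sup>2"
    if p: "p permutes {1..N}" for p
  proof -
    have "aauv N c (\<lambda>n. X (p n)) = aauv N c (\<lambda>n. y (p n))"
      using aauv_shift[OF c(1), of "\<lambda>n. X (p n)" "sample_mean N X"] by (simp add: y_def)
    \<comment> \<open>Permuting the centered sample keeps it centered, so
      \<open>aauv_centered\<close> applies to it as well.\<close>
    also have "\<dots> = (\<Sum>n = 1..N. (y (p n))\<^sup>2) / N + (\<Sum>m = 1..N. c m * y (p m))\<^sup>2"
      using sum.permute[OF p, of y] y assms by (intro aauv_centered) (auto simp: o_def)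
    also have "(\<Sum>n = 1..N. (y (p n))\<^sup>2) = V"
      using sum.permute[OF p, of "\<lambda>n. (y n)\<^sup>2"] by (simp add: V_def o_def)
    finally show ?thesis .
  qed
  then have "permutation_average_aauv N c X = (1 / fact N) *
      (\<Sum>p | p permutes {1..N}. V / N + (\<Sum>m = 1..N. c m * y (p m))\<^sup>2)"
    by (simp add: permutation_average_aauv_def)
  also have "\<dots> = (1 / fact N) * (fact N * (V / N) + fact N * V / (N * (real N - 1)))"
    using sum_permutes_weighted_sum_sq[OF _ _ y c] assms card_permutations[of "{1..N}" N]
    by (simp add: sum.distrib V_def)
  also have "\<dots> = V / N + V / (N * (real N - 1))"
    by (simp add: distrib_left)
  \<comment> \<open>The bias of \<open>V / N\<close> is repaired exactly: 1/N + 1/(N(N - 1)) = 1/(N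
    - 1).\<close>
  also have "\<dots> = V / (real N - 1)"
    using assms by (simp add: field_simps)
  finally show ?thesis
    by (simp add: unbiased_variance_def V_def y_def)
qed

end
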